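(* Let $\sigma \geq p/2$, and let $y_\alpha^n\in H$ ($\alpha=1,2,\ldots,p$, $n=0,1,\ldots,N$) satisfy the scheme $$R_\alpha \frac{y^{n+1}_\alpha - y^{n}_\alpha}{\tau} + \sigma R_\alpha A R_\alpha (y^{n+1}_\alpha - y^{n}_\alpha) + R_\alpha \sum_{\beta =1}^{p} A R_\beta y^{n}_\beta = 0, \quad n = 0,1, \ldots, N-1 ,$$ $$y^{0}_\alpha = u^0 , \quad \alpha = 1,2, \ldots, p .$$ Then for $$y^{n+1} = \sum_{\alpha = 1}^{p} R_\alpha y_\alpha^{n+1} , \quad n = 0,1, \ldots, N-1 ,$$ the a priori estimate $$\|y^{n+1}\|_A \leq \| u^0 \|_A, \quad n = 0,1, \ldots, N-1 ,$$ holds.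
   Context: $H$ is a finite-dimensional Hilbert space with scalar product $(u,v)$; $I$ is the identity operator on $H$. $A: H\to H$ is a constant linear operator which is self-adjoint and positive, $A=A^*>0$ (i.e. $(Au,u)>0$ for $u\ne 0$), and $\|u\|_A=(Au,u)^{1/2}$. The operators $R_\alpha:H\to H$, $\alpha=1,2,\ldots,p$, are linear and give an additive decomposition of the identity: $I=\sum_{\alpha=1}^p R_\alpha$, with $R_\alpha=R_\alpha^*\ge 0$ (self-adjoint, $(R_\alpha u,u)\ge 0$ for all $u$), $\alpha=1,\ldots,p$. Here $u^0\in H$ is given, $\tau>0$ is the time step with $N\tau=T$, and $\sigma$ is a constant. *)

theory Defs
  imports "HOL-Analysis.Analysis"
begin

definition self_adjoint :: "('a::euclidean_space \<Rightarrow> 'a) \<Rightarrow> bool" where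
  "self_adjoint A \<longleftrightarrow> linear A \<and> adjoint A = A"

definition positive_op :: "('a::real_inner \<Rightarrow> 'a) \<Rightarrow> bool" where
  "positive_op A \<longleftrightarrow> (\<forall>u. u \<noteq> 0 \<longrightarrow> A u \<bullet> u > 0)"

definition nonneg_op :: "('a::real_inner \<Rightarrow> 'a) \<Rightarrow> bool" where
  "nonneg_op A \<longleftrightarrow> (\<forall>u. A u \<bullet> u \<ge> 0)"

definition energy_norm :: "('a::real_inner \<Rightarrow> 'a) \<Rightarrow> 'a \<Rightarrow> real" where
  "energy_norm A u = sqrt (A u \<bullet> u)"

end

theory Submission
  imports Defs
begin

text \<open>
  Call \<open>(A u, u)\<close> the energy of \<open>u\<close>. Testing the equation for component \<open>\<alpha>\<close> with the increment
  \<open>d \<alpha> = y \<alpha> (n + 1) - y \<alpha> n\<close> and summing over \<open>\<alpha>\<close> leaves, by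
  self-adjointness of \<open>R \<alpha>\<close>, only quantities of the composite solution
  \<open>v = \<Sum>R \<alpha> (y \<alpha> n)\<close> and its partial increments \<open>w \<alpha> = R \<alpha> (d \<alpha>)\<close>:
  \[ \frac1\tau \sum_\alpha (R_\alpha d_\alpha, d_\alpha)
     + \sigma \sum_\alpha \|w_\alpha\|_A^2 + \Bigl(A v, \sum_\alpha w_\alpha\Bigr) = 0. \]
  The first sum is nonnegative, so \<open>2 (A v, \<Sum>w \<alpha>)\<close>, the linear term in the expansion
  of the energy of \<open>v + \<Sum>w \<alpha>\<close>, is at most \<open>- 2 \<sigma> \<Sum>(A (w \<alpha>), w \<alpha>)\<close>. The quadratic
  term, the energy of \<open>\<Sum>w \<alpha>\<close>, is at most \<open>p \<Sum>(A (w \<alpha>), w \<alpha>)\<close>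
  (\<open>energy_sum_le\<close>), and \<open>2 \<sigma> \<ge> p\<close> makes the total change nonpositive
  (\<open>energy_step_le\<close>). The energy therefore never exceeds its initial value, and the
  composite solution starts at \<open>u0\<close> because the \<open>R \<alpha>\<close> add up to the identity.
\<close>

text \<open>
  This is the Cauchy--Schwarz inequality for a sum of \<open>card S\<close> vectors. It follows by summing
  the nonnegative energies of the differences \<open>x a - x b\<close> over all pairs: the two mixed
  terms each sum to the energy of \<open>\<Sum>x a\<close>.
\<close>
lemma energy_sum_le:
  fixes A :: "'a::real_inner \<Rightarrow> 'a"
  assumes lin: "linear A" and nonneg: "nonneg_op A"
  shows "A (\<Sum>a\<in>S. x a) \<bullet> (\<Sum>a\<in>S. x a) \<le> real (card S) * (\<Sum>a\<in>S. A (x a) \<bullet> x a)"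
proof -
  have mixed: "(\<Sum>a\<in>S. \<Sum>b\<in>S. A (x a) \<bullet> x b) = A (\<Sum>a\<in>S. x a) \<bullet> (\<Sum>a\<in>S. x a)"
    unfolding linear_sum[OF lin] inner_sum_left inner_sum_right by (rule sum.swap)
  have mixed': "(\<Sum>a\<in>S. \<Sum>b\<in>S. A (x b) \<bullet> x a) = A (\<Sum>a\<in>S. x a) \<bullet> (\<Sum>a\<in>S. x a)"
    by (subst sum.swap) (rule mixed)
  have "0 \<le> (\<Sum>a\<in>S. \<Sum>b\<in>S. A (x a - x b) \<bullet> (x a - x b))"
    using nonneg unfolding nonneg_op_def by (intro sum_nonneg) auto
  also have "\<dots> = (\<Sum>a\<in>S. \<Sum>b\<in>S. (A (x a) \<bullet> x a + A (x b) \<bullet> x b) - (A (x a) \<bullet> x b + A (x b) \<bullet> x a))"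
    by (simp add: linear_diff[OF lin] inner_diff_left inner_diff_right algebra_simps)
  also have "\<dots> = 2 * (real (card S) * (\<Sum>a\<in>S. A (x a) \<bullet> x a)) - 2 * (A (\<Sum>a\<in>S. x a) \<bullet> (\<Sum>a\<in>S. x a))"
    by (simp only: sum_subtractf sum.distrib mixed mixed') (simp add: sum_distrib_left)
  finally show ?thesis by simp
qed

text \<open>
  One time step: \<open>v\<close> is the composite solution at the old time level and \<open>d a\<close> is the increment
  of component \<open>a\<close>. The lower bound on \<open>\<sigma>\<close> is exactly what lets the regularising term absorb
  the energy of the composite increment.
\<close>
lemma energy_step_le:
  fixes A :: "'a::euclidean_space \<Rightarrow> 'a"
  assumes A: "self_adjoint A" "nonneg_op A"
    and R: "\<And>a. a \<in> S \<Longrightarrow> self_adjoint (R a)" "\<And>a. a \<in> S \<Longrightarrow> nonneg_op (R a)"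
    and \<tau>: "\<tau> > 0"
    and \<sigma>: "\<sigma> \<ge> real (card S) / 2"
    and eq: "\<And>a. a \<in> S \<Longrightarrow> R a (d a /\<^sub>R \<tau>) + \<sigma> *\<^sub>R R a (A (R a (d a))) + R a (A v) = 0"
  shows "A (v + (\<Sum>a\<in>S. R a (d a))) \<bullet> (v + (\<Sum>a\<in>S. R a (d a))) \<le> A v \<bullet> v"
proof -
  define w where "w = (\<Sum>a\<in>S. R a (d a))"
  define E where "E = (\<Sum>a\<in>S. A (R a (d a)) \<bullet> R a (d a))"
  have linA: "linear A" and symA: "A u \<bullet> z = u \<bullet> A z" for u z
    using A(1) adjoint_works[of A u z] by (auto simp: self_adjoint_def)
  have tested: "A v \<bullet> R a (d a) \<le> - \<sigma> * (A (R a (d a)) \<bullet> R a (d a))" if a: "a \<in> S" for a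
  proof -
    have linR: "linear (R a)" and symR: "R a u \<bullet> z = u \<bullet> R a z" for u z
      using R(1)[OF a] adjoint_works[of "R a" u z] by (auto simp: self_adjoint_def)
    have "(R a (d a) \<bullet> d a) / \<tau> + \<sigma> * (A (R a (d a)) \<bullet> R a (d a)) + A v \<bullet> R a (d a)
        = (R a (d a /\<^sub>R \<tau>) + \<sigma> *\<^sub>R R a (A (R a (d a))) + R a (A v)) \<bullet> d a"
      by (simp add: inner_add_left linear_scale[OF linR] symR divide_inverse mult.commute)
    also have "\<dots> = 0"
      by (simp add: eq[OF a])
    finally have "(R a (d a) \<bullet> d a) / \<tau> + \<sigma> * (A (R a (d a)) \<bullet> R a (d a)) + A v \<bullet> R a (d a) = 0" .
    moreover have "(R a (d a) \<bullet> d a) / \<tau> \<ge> 0"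
      using R(2)[OF a] \<tau> by (simp add: nonneg_op_def)
    ultimately show ?thesis by simp
  qed
  have cross: "A v \<bullet> w \<le> - \<sigma> * E"
    using sum_mono[OF tested] by (simp add: w_def E_def inner_sum_right sum_distrib_left)
  have "E \<ge> 0"
    using A(2) by (auto simp: E_def nonneg_op_def intro: sum_nonneg)
  then have "real (card S) * E \<le> 2 * \<sigma> * E"
    using \<sigma> by (intro mult_right_mono) auto
  moreover have "A w \<bullet> w \<le> real (card S) * E"
    unfolding w_def E_def by (rule energy_sum_le[OF linA A(2)])
  moreover have "A (v + w) \<bullet> (v + w) = A v \<bullet> v + 2 * (A v \<bullet> w) + A w \<bullet> w"
    using symA[of w v] by (simp add: linear_add[OF linA] inner_add_left inner_add_right inner_commute)
  ultimately have "A (v + w) \<bullet> (v + w) \<le> A v \<bullet> v"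
    using cross by simp
  then show ?thesis by (simp add: w_def)
qed

theorem theorem3:
  fixes A :: "'a::euclidean_space \<Rightarrow> 'a"
    and R :: "nat \<Rightarrow> 'a \<Rightarrow> 'a"
    and y :: "nat \<Rightarrow> nat \<Rightarrow> 'a"
    and u0 :: 'a
    and p N :: nat
    and \<tau> T \<sigma> :: real
  assumes A: "self_adjoint A" "positive_op A"
    and R: "\<forall>\<alpha>\<in>{1..p}. self_adjoint (R \<alpha>) \<and> nonneg_op (R \<alpha>)"
    and decomposition: "\<forall>u. u = (\<Sum>\<alpha>=1..p. R \<alpha> u)"
    and step: "\<tau> > 0" "real N * \<tau> = T"
    and sigma: "\<sigma> \<ge> real p / 2"
    and scheme: "\<forall>\<alpha>\<in>{1..p}. \<forall>n<N.
          R \<alpha> ((y \<alpha> (n + 1) - y \<alpha> n) /\<^sub>R \<tau>)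
          + \<sigma> *\<^sub>R R \<alpha> (A (R \<alpha> (y \<alpha> (n + 1) - y \<alpha> n)))
          + R \<alpha> (\<Sum>\<beta>=1..p. A (R \<beta> (y \<beta> n))) = 0"
    and initial: "\<forall>\<alpha>\<in>{1..p}. y \<alpha> 0 = u0"
  shows "\<forall>n<N. energy_norm A (\<Sum>\<alpha>=1..p. R \<alpha> (y \<alpha> (n + 1))) \<le> energy_norm A u0"
proof -
  define Y where "Y n = (\<Sum>\<alpha>=1..p. R \<alpha> (y \<alpha> n))" for n
  have linA: "linear A" and nonnegA: "nonneg_op A"
    using A by (auto simp: self_adjoint_def positive_op_def nonneg_op_def)
      (metis inner_zero_right less_eq_real_def)
  have "A (Y n) \<bullet> Y n \<le> A u0 \<bullet> u0" if "n \<le> N" for n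
    using that
  proof (induction n)
    case 0
    have "Y 0 = u0"
      using decomposition[rule_format, of u0] initial by (simp add: Y_def)
    then show ?case by simp
  next
    case (Suc n)
    define d where "d \<alpha> = y \<alpha> (Suc n) - y \<alpha> n" for \<alpha>
    have "Y (Suc n) - Y n = (\<Sum>\<alpha>=1..p. R \<alpha> (d \<alpha>))"
      unfolding Y_def d_def sum_subtractf[symmetric]
      using R by (intro sum.cong) (auto simp: self_adjoint_def linear_diff)
    then have increment: "Y (Suc n) = Y n + (\<Sum>\<alpha>=1..p. R \<alpha> (d \<alpha>))"
      by (simp add: algebra_simps)
    have "(\<Sum>\<beta>=1..p. A (R \<beta> (y \<beta> n))) = A (Y n)"
      by (simp add: Y_def linear_sum[OF linA])
    then have "R \<alpha> (d \<alpha> /\<^sub>R \<tau>) + \<sigma> *\<^sub>R R \<alpha> (A (R \<alpha> (d \<alpha>))) + R \<alpha> (A (Y n)) = 0"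
      if "\<alpha> \<in> {1..p}" for \<alpha>
      using scheme[rule_format, OF that, of n] Suc.prems by (simp add: d_def)
    then have "A (Y (Suc n)) \<bullet> Y (Suc n) \<le> A (Y n) \<bullet> Y n"
      unfolding increment
      by (intro energy_step_le[where \<tau> = \<tau> and \<sigma> = \<sigma>]) (use A nonnegA R step sigma in auto)
    with Suc show ?case by simp
  qed
  then show ?thesis
    by (simp add: energy_norm_def Y_def)
qed

end
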